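(* Let $\varrho$ be a substitution of constant length $L$ over a finite alphabet $\mathcal{A}$ which admits a partition $\mathcal{A}=\mathcal{A}_1\cup\mathcal{A}_2\cup\cdots\cup\mathcal{A}_n$ that induces a supersubstitution $\xi$ on $\{1,2,\dots,n\}$. Suppose $\mathcal{A}_1=\{a_1\}$ is a singleton and that $\xi$ is aperiodic, primitive, bijective and satisfies $\xi_0=\mathrm{id}$, with column group $G$. Let $v$ be the fixed point of $\varrho$ starting with $a_1$. Then $$A_v\left(\frac{L^{k|G|}-1}{L^k-1}\right)\geqslant L^k\qquad\text{for all } k\geqslant 1.$$
   Context: $\mathbb{N}=\mathbb{Z}_{\geqslant 0}$. A substitution of constant length $L$ on a finite alphabet $\mathcal{A}$ is a map $\varrho\colon\mathcal{A}\to\mathcal{A}^L$, extended to words by concatenation; its $\ell$-th column ($0\leqslant\ell\leqslant L-1$) is the map $\varrho_\ell\colon\mathcal{A}\to\mathcal{A}$ sending $a$ to the $\ell$-th letter of $\varrho(a)$ (indices from $0$). It is bijective if every column is a bijection, and primitive if some power has the property that the image of every letter contains all letters. A fixed point is an infinite word $w\in\mathcal{A}^{\mathbb{N}}$ with $\varrho(w)=w$; a substitution is aperiodic if it has no fixed point of the form $u^\infty$ with $u$ a finite word. The column group of a bijective substitution is the group of permutations generated by its columns. Supersubstitution: a partition $\mathcal{A}=\mathcal{A}_1\cup\cdots\cup\mathcal{A}_n$ (disjoint non-empty parts) induces a supersubstitution for $\varrho$ if for every $\ell\in\{0,\dots,L-1\}$, every $i\in\{1,\dots,n\}$ and all $a,b\in\mathcal{A}_i$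 there is $j$ such that $\varrho_\ell(a)$ and $\varrho_\ell(b)$ both lie in $\mathcal{A}_j$. The induced substitution $\xi$ of length $L$ on $\{1,\dots,n\}$ is given by $\xi_\ell(i)=j$, where $j$ is such that $\varrho_\ell(a)\in\mathcal{A}_j$ for each $a\in\mathcal{A}_i$. For an infinite word $v$ and $d\geqslant1$, $A_v(d)$ is the maximum (supremum, in $\mathbb{N}\cup\{\infty\}$) of all $M$ such that there is $s\in\mathbb{N}$ with $v_s=v_{s+dm}$ for all $0\leqslant m\leqslant M-1$. *)

theory Defs
  imports
    "HOL-Library.Extended_Nat"
    "HOL-Library.Disjoint_Sets"
    "HOL-Algebra.Bij"
    "HOL-Algebra.Generated_Groups"
begin

text \<open>
  Alphabets are explicit carrier sets \<open>A\<close>, because a substitution on an arbitrary alphabet is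
  related below to one on \<open>{1..n}\<close>; the values of a substitution outside its alphabet are
  irrelevant. Infinite words are functions on \<open>nat\<close>.
\<close>

definition const_length_subst :: "nat \<Rightarrow> 'a set \<Rightarrow> ('a \<Rightarrow> 'a list) \<Rightarrow> bool" where
  "const_length_subst L A \<sigma> \<longleftrightarrow>
     0 < L \<and> (\<forall>a\<in>A. length (\<sigma> a) = L \<and> set (\<sigma> a) \<subseteq> A)"

definition subst_column :: "('a \<Rightarrow> 'a list) \<Rightarrow> nat \<Rightarrow> 'a \<Rightarrow> 'a" where
  "subst_column \<sigma> l a = \<sigma> a ! l"

definition subst_word :: "('a \<Rightarrow> 'a list) \<Rightarrow> 'a list \<Rightarrow> 'a list" where
  "subst_word \<sigma> u = concat (map \<sigma> u)"

text \<open>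
  As all blocks have length \<open>L\<close>, position \<open>i\<close> of the infinite concatenation
  \<open>\<sigma> (w 0) @ \<sigma> (w 1) @ \<dots>\<close> lies in block \<open>i div L\<close> at offset \<open>i mod L\<close>.
\<close>

definition subst_inf :: "nat \<Rightarrow> ('a \<Rightarrow> 'a list) \<Rightarrow> (nat \<Rightarrow> 'a) \<Rightarrow> nat \<Rightarrow> 'a" where
  "subst_inf L \<sigma> w i = \<sigma> (w (i div L)) ! (i mod L)"

definition subst_fixed_point ::
    "nat \<Rightarrow> 'a set \<Rightarrow> ('a \<Rightarrow> 'a list) \<Rightarrow> (nat \<Rightarrow> 'a) \<Rightarrow> bool" where
  "subst_fixed_point L A \<sigma> w \<longleftrightarrow> range w \<subseteq> A \<and> subst_inf L \<sigma> w = w"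

definition omega_power :: "'a list \<Rightarrow> nat \<Rightarrow> 'a" where
  "omega_power u i = u ! (i mod length u)"

definition aperiodic_subst :: "nat \<Rightarrow> 'a set \<Rightarrow> ('a \<Rightarrow> 'a list) \<Rightarrow> bool" where
  "aperiodic_subst L A \<sigma> \<longleftrightarrow>
     \<not> (\<exists>u. u \<noteq> [] \<and> subst_fixed_point L A \<sigma> (omega_power u))"

definition primitive_subst :: "'a set \<Rightarrow> ('a \<Rightarrow> 'a list) \<Rightarrow> bool" where
  "primitive_subst A \<sigma> \<longleftrightarrow>
     (\<exists>p\<ge>1. \<forall>a\<in>A. A \<subseteq> set ((subst_word \<sigma> ^^ p) [a]))"

definition bijective_subst :: "nat \<Rightarrow> 'a set \<Rightarrow> ('a \<Rightarrow> 'a list) \<Rightarrow> bool" where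
  "bijective_subst L A \<sigma> \<longleftrightarrow> (\<forall>l<L. bij_betw (subst_column \<sigma> l) A A)"

text \<open>
  \<^const>\<open>BijGroup\<close> consists of the bijections of \<open>A\<close> that are \<open>undefined\<close> outside \<open>A\<close>,
  which is why the columns are restricted.
\<close>

definition column_group :: "nat \<Rightarrow> 'a set \<Rightarrow> ('a \<Rightarrow> 'a list) \<Rightarrow> ('a \<Rightarrow> 'a) monoid" where
  "column_group L A \<sigma> =
     (BijGroup A)\<lparr>carrier :=
        generate (BijGroup A) {restrict (subst_column \<sigma> l) A | l. l < L}\<rparr>"

definition is_partition :: "'a set \<Rightarrow> nat \<Rightarrow> (nat \<Rightarrow> 'a set) \<Rightarrow> bool" where
  "is_partition A n P \<longleftrightarrow>
     A = (\<Union>i\<in>{1..n}. P i) \<and> disjoint_family_on P {1..n} \<and> (\<forall>i\<in>{1..n}. P i \<noteq> {})"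

definition induces_supersubst ::
    "nat \<Rightarrow> ('a \<Rightarrow> 'a list) \<Rightarrow> nat \<Rightarrow> (nat \<Rightarrow> 'a set) \<Rightarrow> bool" where
  "induces_supersubst L \<sigma> n P \<longleftrightarrow>
     (\<forall>l<L. \<forall>i\<in>{1..n}. \<forall>a\<in>P i. \<forall>b\<in>P i.
        \<exists>j\<in>{1..n}. subst_column \<sigma> l a \<in> P j \<and> subst_column \<sigma> l b \<in> P j)"

definition supersubst ::
    "nat \<Rightarrow> ('a \<Rightarrow> 'a list) \<Rightarrow> nat \<Rightarrow> (nat \<Rightarrow> 'a set) \<Rightarrow> nat \<Rightarrow> nat list" where
  "supersubst L \<sigma> n P i =
     map (\<lambda>l. THE j. j \<in> {1..n} \<and> (\<forall>a\<in>P i. subst_column \<sigma> l a \<in> P j)) [0..<L]"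

definition max_ap_length :: "(nat \<Rightarrow> 'a) \<Rightarrow> nat \<Rightarrow> enat" where
  "max_ap_length v d = Sup {enat M | M. \<exists>s. \<forall>m<M. v s = v (s + d * m)}"

lemma supersubst_const_length:
  assumes P: "is_partition A n P" and \<sigma>: "const_length_subst L A \<sigma>"
    and ind: "induces_supersubst L \<sigma> n P"
  shows "const_length_subst L {1..n} (supersubst L \<sigma> n P)"
    and "\<And>l i a. \<lbrakk>l < L; i \<in> {1..n}; a \<in> P i\<rbrakk> \<Longrightarrow>
           subst_column \<sigma> l a \<in> P (subst_column (supersubst L \<sigma> n P) l i)"
proof -
  have *: "\<exists>!j. j \<in> {1..n} \<and> (\<forall>a\<in>P i. subst_column \<sigma> l a \<in> P j)"
    if l: "l < L" and i: "i \<in> {1..n}" for l i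
  proof -
    obtain a where a: "a \<in> P i"
      using P i unfolding is_partition_def by blast
    obtain j where j: "j \<in> {1..n}" "subst_column \<sigma> l a \<in> P j"
      using ind l i a unfolding induces_supersubst_def by blast
    have uniq: "j' = j" if "j' \<in> {1..n}" "subst_column \<sigma> l a \<in> P j'" for j'
      using P j that unfolding is_partition_def disjoint_family_on_def by blast
    have "subst_column \<sigma> l b \<in> P j" if "b \<in> P i" for b
      using ind l i a that uniq unfolding induces_supersubst_def by blast
    then show ?thesis
      using j(1) uniq a by blast
  qed
  have **: "subst_column (supersubst L \<sigma> n P) l i \<in> {1..n} \<and>
      (\<forall>a\<in>P i. subst_column \<sigma> l a \<in> P (subst_column (supersubst L \<sigma> n P) l i))"
    if "l < L" "i \<in> {1..n}" for l i
    using theI'[OF *[OF that]] that by (simp add: subst_column_def supersubst_def)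
  then show "\<And>l i a. \<lbrakk>l < L; i \<in> {1..n}; a \<in> P i\<rbrakk> \<Longrightarrow>
      subst_column \<sigma> l a \<in> P (subst_column (supersubst L \<sigma> n P) l i)"
    by blast
  have "length (supersubst L \<sigma> n P i) = L" for i
    by (simp add: supersubst_def)
  then show "const_length_subst L {1..n} (supersubst L \<sigma> n P)"
    using \<sigma> ** unfolding const_length_subst_def subst_column_def
    by (metis in_set_conv_nth subsetI)
qed

lemma fixed_point_ex1:
  assumes "const_length_subst L A \<sigma>" "2 \<le> L" "a \<in> A" "subst_column \<sigma> 0 a = a"
  shows "\<exists>!w. subst_fixed_point L A \<sigma> w \<and> w 0 = a"
proof -
  define R where "R = (\<lambda>(f :: nat \<Rightarrow> 'a) i. if i = 0 then a else \<sigma> (f (i div L)) ! (i mod L))"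
  define w where "w = wfrec less_than R"
  have w: "w i = (if i = 0 then a else \<sigma> (w (i div L)) ! (i mod L))" for i
    using \<open>2 \<le> L\<close> unfolding w_def
    by (subst wfrec[OF wf_less_than]) (simp add: R_def cut_def)
  have "w i \<in> A" for i
  proof (induction i rule: less_induct)
    case (less i)
    show ?case
    proof (cases "i = 0")
      case False
      then have "w (i div L) \<in> A" using less \<open>2 \<le> L\<close> by simp
      then have "\<sigma> (w (i div L)) ! (i mod L) \<in> A"
        using assms(1) unfolding const_length_subst_def
        by (metis mod_less_divisor nth_mem subsetD)
      then show ?thesis using False w[of i] by simp
    qed (use w assms in simp)
  qed
  moreover have "subst_inf L \<sigma> w = w"
  proof
    fix i
    show "subst_inf L \<sigma> w i = w i"
      using w[of i] w[of 0] assms(4) by (cases "i = 0") (auto simp: subst_inf_def subst_column_def)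
  qed
  moreover have "w 0 = a" using w[of 0] by simp
  moreover have "w' = w" if "subst_fixed_point L A \<sigma> w'" "w' 0 = a" for w'
  proof
    fix i
    show "w' i = w i"
    proof (induction i rule: less_induct)
      case (less i)
      have "w' i = \<sigma> (w' (i div L)) ! (i mod L)"
        using that(1) unfolding subst_fixed_point_def by (metis subst_inf_def)
      then show ?case
        using less[of "i div L"] \<open>2 \<le> L\<close> w[of i] that(2) by (cases "i = 0") auto
    qed
  qed
  ultimately show ?thesis
    unfolding subst_fixed_point_def by blast
qed

text \<open>Truncating division by \<open>L ^ k - 1\<close> is exact in the quotient
  \<open>(L ^ (k * g) - 1) div (L ^ k - 1)\<close>.\<close>

lemma power_minus_one_dvd: "(L ^ k - 1 :: nat) dvd L ^ (k * g) - 1"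
proof (cases "L = 0")
  case False
  then have "int (L ^ k - 1) dvd int (L ^ (k * g) - 1)"
    using power_diff_1_eq[of "int L ^ k" g] by (simp add: of_nat_diff power_mult Suc_leI)
  then show ?thesis by (simp only: of_nat_dvd_iff)
qed (cases "k = 0"; cases "g = 0"; simp add: power_0_left)

end

theory Submission
  imports Defs "HOL-Algebra.Multiplicative_Group"
begin

text \<open>
  Project \<open>v\<close> to the fixed point \<open>w\<close> of \<open>\<xi>\<close> starting with \<open>1\<close>; since \<open>P 1\<close> is a singleton,
  \<open>v\<close> equals \<open>a\<^sub>1\<close> wherever \<open>w\<close> equals \<open>1\<close>. Put \<open>K = L ^ k\<close> and let \<open>g\<close> be the order of the
  column group. For \<open>m < K\<close> the multiple \<open>m * (K ^ g - 1) / (K - 1)\<close> is written in base \<open>K\<close>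
  with \<open>g\<close> digits, all equal to \<open>m\<close>, so \<open>w\<close> takes there the value \<open>(h ^ g) 1\<close>, where \<open>h\<close> is the
  \<open>m\<close>-th column of \<open>\<xi> ^ k\<close>. As \<open>h\<close> lies in the column group, \<open>h ^ g\<close> is the identity: the
  progression starting at \<open>0\<close> has the required length.
\<close>

text \<open>The group laws are inherited from \<open>BijGroup A\<close>, in which the restricted
  columns generate a subgroup.\<close>

lemma group_column_group:
  assumes "bijective_subst L A \<sigma>"
  shows "group (column_group L A \<sigma>)"
    and "l < L \<Longrightarrow> restrict (subst_column \<sigma> l) A \<in> carrier (column_group L A \<sigma>)"
    and "carrier (column_group L A \<sigma>) \<subseteq> Bij A"
proof -
  interpret B: group "BijGroup A" by (rule group_BijGroup)
  have "{restrict (subst_column \<sigma> l) A | l. l < L} \<subseteq> carrier (BijGroup A)"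
    using assms by (auto simp: BijGroup_def Bij_def bijective_subst_def)
  then have sub: "subgroup (carrier (column_group L A \<sigma>)) (BijGroup A)"
    unfolding column_group_def by (simp add: B.generate_is_subgroup)
  show "group (column_group L A \<sigma>)"
    using B.subgroup_imp_group[OF sub] by (simp add: column_group_def)
  show "carrier (column_group L A \<sigma>) \<subseteq> Bij A"
    using subgroup.subset[OF sub] by (simp add: BijGroup_def)
  show "restrict (subst_column \<sigma> l) A \<in> carrier (column_group L A \<sigma>)" if "l < L"
    using that unfolding column_group_def by (auto intro!: generate.incl)
qed

lemma mult_column_group:
  assumes "bijective_subst L A \<sigma>"
    and "f \<in> carrier (column_group L A \<sigma>)" "h \<in> carrier (column_group L A \<sigma>)" "x \<in> A"
  shows "(f \<otimes>\<^bsub>column_group L A \<sigma>\<^esub> h) x = f (h x)"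
proof -
  have "f \<in> Bij A" "h \<in> Bij A"
    using assms group_column_group(3) by blast+
  then show ?thesis
    using \<open>x \<in> A\<close> by (simp add: column_group_def BijGroup_def compose_def)
qed

lemma one_column_group: "x \<in> A \<Longrightarrow> \<one>\<^bsub>column_group L A \<sigma>\<^esub> x = x"
  by (simp add: column_group_def BijGroup_def)

text \<open>The permutation \<open>h\<close> is the composition of the columns indexed by the
  \<open>k\<close> base-\<open>L\<close> digits of \<open>r\<close>, the lowest digit acting last.
  Hence it does not depend on \<open>q\<close>.\<close>

lemma fixed_point_power_column:
  assumes "bijective_subst L A \<sigma>" "subst_fixed_point L A \<sigma> w" "r < L ^ k"
  shows "\<exists>h\<in>carrier (column_group L A \<sigma>). \<forall>q. w (L ^ k * q + r) = h (w q)"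
  using assms(3)
proof (induction k arbitrary: r)
  case 0
  interpret group "column_group L A \<sigma>" using assms(1) by (rule group_column_group)
  have "w q \<in> A" for q
    using assms(2) by (auto simp: subst_fixed_point_def)
  with 0 show ?case
    by (intro bexI[of _ "\<one>\<^bsub>column_group L A \<sigma>\<^esub>"]) (auto simp: one_column_group)
next
  case (Suc k)
  interpret group "column_group L A \<sigma>" using assms(1) by (rule group_column_group)
  have wA: "w q \<in> A" for q
    using assms(2) by (auto simp: subst_fixed_point_def)
  have "0 < L" using Suc.prems by (cases "L = 0") auto
  have "r div L < L ^ k"
    using Suc.prems by (simp add: less_mult_imp_div_less mult.commute)
  from Suc.IH[OF this] obtain h where h: "h \<in> carrier (column_group L A \<sigma>)"
    and wh: "\<And>q. w (L ^ k * q + r div L) = h (w q)" by blast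
  \<comment> \<open>The induction hypothesis handles the digits of \<open>r div L\<close>; the
    remaining lowest digit contributes \<open>c\<close>.\<close>
  define c where "c = restrict (subst_column \<sigma> (r mod L)) A"
  have c: "c \<in> carrier (column_group L A \<sigma>)"
    unfolding c_def using group_column_group(2)[OF assms(1)] \<open>0 < L\<close> by simp
  have "w (L ^ Suc k * q + r) = (c \<otimes>\<^bsub>column_group L A \<sigma>\<^esub> h) (w q)" for q
  proof -
    have "L ^ Suc k * q + r = L * (L ^ k * q) + r" by simp
    then have "(L ^ Suc k * q + r) div L = L ^ k * q + r div L"
      and "(L ^ Suc k * q + r) mod L = r mod L"
      using \<open>0 < L\<close> by (simp_all only: div_mult_self4 mod_mult_self4)
    then have "w (L ^ Suc k * q + r) = subst_column \<sigma> (r mod L) (w (L ^ k * q + r div L))"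
      using assms(2) unfolding subst_fixed_point_def subst_column_def by (metis subst_inf_def)
    also have "\<dots> = c (h (w q))"
      using wA[of "L ^ k * q + r div L"] by (simp add: c_def wh)
    finally show ?thesis
      using mult_column_group[OF assms(1) c h wA] by simp
  qed
  then show ?case using c h by blast
qed

text \<open>Substituting \<open>K = Suc c\<close> turns the truncated subtractions into an additive
  identity provable by induction.\<close>

lemma geometric_sum_nat_div:
  fixes K i :: nat
  assumes "2 \<le> K"
  shows "(K ^ i - 1) div (K - 1) = (\<Sum>j<i. K ^ j)"
proof -
  obtain c where "K = Suc c" "0 < c" using assms by (cases K) auto
  moreover have "Suc c ^ i = 1 + c * (\<Sum>j<i. Suc c ^ j)"
    by (induction i) (simp_all add: algebra_simps)
  ultimately show ?thesis by simp
qed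

lemma fixed_point_repdigit:
  assumes "bijective_subst L A \<sigma>" "subst_fixed_point L A \<sigma> w" "m < L ^ k"
  shows "w ((L ^ (k * order (column_group L A \<sigma>)) - 1) div (L ^ k - 1) * m) = w 0"
proof (cases "L ^ k \<ge> 2")
  case True
  let ?G = "column_group L A \<sigma>"
  interpret group ?G using assms(1) by (rule group_column_group)
  have wA: "w q \<in> A" for q
    using assms(2) by (auto simp: subst_fixed_point_def)
  obtain h where h: "h \<in> carrier ?G" and wh: "\<And>q. w (L ^ k * q + m) = h (w q)"
    using fixed_point_power_column[OF assms] by blast
  have repdigit: "w ((\<Sum>j<i. (L ^ k) ^ j) * m) = (h [^]\<^bsub>?G\<^esub> i) (w 0)" for i
  proof (induction i)
    case 0
    then show ?case by (simp add: one_column_group wA)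
  next
    case (Suc i)
    \<comment> \<open>Horner's scheme: a further digit \<open>m\<close> is appended at the low
      end.\<close>
    have "(\<Sum>j<Suc i. (L ^ k) ^ j) * m = L ^ k * ((\<Sum>j<i. (L ^ k) ^ j) * m) + m"
      by (simp add: sum.lessThan_Suc_shift sum_distrib_left sum_distrib_right algebra_simps
          del: sum.lessThan_Suc)
    then have "w ((\<Sum>j<Suc i. (L ^ k) ^ j) * m) = h ((h [^]\<^bsub>?G\<^esub> i) (w 0))"
      by (simp only: wh Suc.IH)
    also have "\<dots> = (h [^]\<^bsub>?G\<^esub> Suc i) (w 0)"
      by (simp only: nat_pow_Suc2[OF h] mult_column_group[OF assms(1) h nat_pow_closed[OF h] wA])
    finally show ?case .
  qed
  \<comment> \<open>Lagrange's theorem; for an infinite group \<open>order\<close> is 0 and the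
    power is trivially the identity.\<close>
  have "w ((\<Sum>j<order ?G. (L ^ k) ^ j) * m) = w 0"
    using h wA by (simp add: repdigit pow_order_eq_1 one_column_group)
  then show ?thesis
    using geometric_sum_nat_div[OF True] by (simp add: power_mult)
\<comment> \<open>If \<open>L ^ k\<close> is less than 2, then \<open>m = 0\<close> and the position
  is 0.\<close>
qed (use assms(3) in auto)

text \<open>Take for \<open>w i\<close> the index of the part containing \<open>v i\<close>. The
  fixed-point equation of \<open>v\<close> also places \<open>v i\<close> in the part given by the
  induced column, and disjointness identifies the two indices.\<close>

lemma fixed_point_projection:
  assumes "is_partition A n P" "const_length_subst L A \<sigma>" "induces_supersubst L \<sigma> n P"
    and "subst_fixed_point L A \<sigma> v"
  obtains w where "subst_fixed_point L {1..n} (supersubst L \<sigma> n P) w" "\<And>i. v i \<in> P (w i)"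
proof -
  have "\<exists>j\<in>{1..n}. v i \<in> P j" for i
    using assms(1,4) unfolding is_partition_def subst_fixed_point_def by blast
  then obtain w where w: "\<And>i. w i \<in> {1..n}" "\<And>i. v i \<in> P (w i)" by metis
  have uniq: "j = j'" if "j \<in> {1..n}" "j' \<in> {1..n}" "x \<in> P j" "x \<in> P j'" for j j' x
    using assms(1) that unfolding is_partition_def disjoint_family_on_def by blast
  have "subst_inf L (supersubst L \<sigma> n P) w i = w i" for i
  proof -
    let ?c = "subst_column (supersubst L \<sigma> n P) (i mod L) (w (i div L))"
    have l: "i mod L < L" using assms(2) by (simp add: const_length_subst_def)
    have "?c \<in> {1..n}"
      using supersubst_const_length(1)[OF assms(1-3)] w(1)[of "i div L"] l
      unfolding const_length_subst_def subst_column_def by (metis nth_mem subsetD)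
    moreover have "v i = subst_column \<sigma> (i mod L) (v (i div L))"
      using assms(4) unfolding subst_fixed_point_def subst_column_def by (metis subst_inf_def)
    then have "v i \<in> P ?c"
      using supersubst_const_length(2)[OF assms(1-3) l w] by simp
    ultimately show ?thesis
      using uniq[of ?c "w i" "v i"] w by (simp add: subst_inf_def subst_column_def)
  qed
  then show thesis
    using that w unfolding subst_fixed_point_def by blast
qed

theorem proposition36:
  fixes A :: "'a set" and \<rho> :: "'a \<Rightarrow> 'a list" and L n k :: nat
    and P :: "nat \<Rightarrow> 'a set" and \<xi> :: "nat \<Rightarrow> nat list"
    and a\<^sub>1 :: 'a and v :: "nat \<Rightarrow> 'a"
  assumes "finite A"
    and "const_length_subst L A \<rho>"
    and "1 \<le> n"
    and "is_partition A n P"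
    and "induces_supersubst L \<rho> n P"
    and "\<xi> = supersubst L \<rho> n P"
    and "P 1 = {a\<^sub>1}"
    and "aperiodic_subst L {1..n} \<xi>"
    and "primitive_subst {1..n} \<xi>"
    and "bijective_subst L {1..n} \<xi>"
    and "\<forall>i\<in>{1..n}. subst_column \<xi> 0 i = i"
    and "subst_fixed_point L A \<rho> v"
    and "v 0 = a\<^sub>1"
    and "1 \<le> k"
  shows "max_ap_length v
           ((L ^ (k * order (column_group L {1..n} \<xi>)) - 1) div (L ^ k - 1)) \<ge> enat (L ^ k)"
proof -
  obtain w where w: "subst_fixed_point L {1..n} \<xi> w" "\<And>i. v i \<in> P (w i)"
    using fixed_point_projection assms(2,4,5,6,12) by metis
  have "w 0 \<in> {1..n}"
    using w(1) by (simp only: subst_fixed_point_def) blast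
  then have "w 0 = 1"
    using assms(3,4,7,13) w(2)[of 0]
    unfolding is_partition_def disjoint_family_on_def by fastforce
  define d where "d = (L ^ (k * order (column_group L {1..n} \<xi>)) - 1) div (L ^ k - 1)"
  \<comment> \<open>Here \<open>w (d * m) = 1\<close>, so \<open>v (d * m)\<close> lies in the
    singleton \<open>P 1\<close>.\<close>
  have "v 0 = v (0 + d * m)" if "m < L ^ k" for m
    using fixed_point_repdigit[OF assms(10) w(1) that] w(2)[of "d * m"] \<open>w 0 = 1\<close> assms(7,13)
    by (simp add: d_def)
  then show ?thesis
    unfolding max_ap_length_def d_def[symmetric] by (intro Sup_upper) blast
qed

end
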